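(* Let $A\in\mathbb R^{n\times n}$ be symmetric positive definite, let $N$, $n_s$, $R_s$, $\tilde A_s$ ($s=1,\dots,N$) satisfy the local setting and let $V_0$, $R_0$ satisfy the coarse setting (both described in the context), with associated operators $H$ and $P_0$. Assume that $$\sum_{s=1}^NR_s^\top\operatorname{Ker}(\tilde A_s)\subset V_0.$$ For each $s=1,\dots,N$, let $\tilde\Pi_s$ be the $A$-orthogonal projection characterized by $\operatorname{Ker}(\tilde\Pi_s)=R_s^\top\operatorname{Ker}(\tilde A_s)$. Assume that there exists $\omega>0$ such that $$\|\tilde\Pi_sR_s^\top x_s\|_A^2\le\omega\,|x_s|_{\tilde A_s}^2\quad\text{for every }s=1,\dots,N\text{ and every }x_s\in\operatorname{range}(\tilde A_s^\dagger R_sP_0^\top).$$ Then the largest eigenvalue $\lambda_{\max}$ of $HAP_0$ satisfies $\lambda_{\max}\le N^c\omega$, where $N^c$ is a coloring constant as defined in the context.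
   Context: Abbreviations: spd = symmetric positive definite, spsd = symmetric positive semi-definite. $B^\dagger$ is the Moore-Penrose pseudo-inverse. $\|x\|_A=(x^\top Ax)^{1/2}$; for an spsd matrix $B$, $|x|_B=(x^\top Bx)^{1/2}$ (a semi-norm). Local setting: $N\in\mathbb N$ is the number of subdomains, and for each $s\in\{1,\dots,N\}$, $n_s\in\mathbb N$, $R_s\in\mathbb R^{n_s\times n}$ and $\tilde A_s\in\mathbb R^{n_s\times n_s}$ are such that: $R_sR_s^\top=I$; $\mathbb R^n=\sum_{s=1}^N\operatorname{range}(R_s^\top)$; each $\tilde A_s$ is spsd; and $H:=\sum_{s=1}^NR_s^\top\tilde A_s^\dagger R_s$ is non-singular (hence spd). Coarse setting: $V_0\subset\mathbb R^n$ is a subspace (the coarse space) and $R_0\in\mathbb R^{\dim(V_0)\times n}$ is a matrix whose rows form a basis of $V_0$, so $V_0=\operatorname{range}(R_0^\top)$. The operator $P_0:=I-R_0^\top(R_0AR_0^\top)^{-1}R_0A$ is the $A$-orthogonal projection with $\operatorname{Ker}(P_0)=V_0$. Coloring constant: $N^c\in\mathbb N$ is such that there are subsets $\mathcal C_1,\dots,\mathcal C_{N^c}$ of $\{1,\dots,N\}$ with $\{1,\dots,N\}=\bigcup_{j}\mathcal C_j$ and, for each $j$ and all $s,t\in\mathcal C_j$ with $s\ne t$, $R_sAR_t^\top=0$. *)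

theory Defs
  imports
    "Jordan_Normal_Form.Matrix_Kernel"
    "Jordan_Normal_Form.Gauss_Jordan_Elimination"
    "Jordan_Normal_Form.Spectral_Radius"
begin

definition spd_mat :: "real mat \<Rightarrow> bool" where
  "spd_mat A \<longleftrightarrow> square_mat A \<and> transpose_mat A = A \<and>
     (\<forall>x \<in> carrier_vec (dim_row A). x \<noteq> 0\<^sub>v (dim_row A) \<longrightarrow> 0 < x \<bullet> (A *\<^sub>v x))"

definition spsd_mat :: "real mat \<Rightarrow> bool" where
  "spsd_mat A \<longleftrightarrow> square_mat A \<and> transpose_mat A = A \<and>
     (\<forall>x \<in> carrier_vec (dim_row A). 0 \<le> x \<bullet> (A *\<^sub>v x))"

text \<open>Used both for the norm of an spd matrix and for the semi-norm of an spsd matrix.\<close>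
definition energy_norm :: "real mat \<Rightarrow> real vec \<Rightarrow> real" where
  "energy_norm A x = sqrt (x \<bullet> (A *\<^sub>v x))"

definition mat_range :: "real mat \<Rightarrow> real vec set" where
  "mat_range M = (\<lambda>x. M *\<^sub>v x) ` carrier_vec (dim_col M)"

definition is_moore_penrose :: "real mat \<Rightarrow> real mat \<Rightarrow> bool" where
  "is_moore_penrose M B \<longleftrightarrow> B \<in> carrier_mat (dim_col M) (dim_row M) \<and>
     M * B * M = M \<and> B * M * B = B \<and>
     transpose_mat (M * B) = M * B \<and> transpose_mat (B * M) = B * M"

definition pinv :: "real mat \<Rightarrow> real mat" where
  "pinv M = (THE B. is_moore_penrose M B)"

text \<open>The Minkowski sum of the subspaces \<open>W 1, \<dots>, W N\<close> of \<open>\<real>\<^sup>n\<close>.\<close>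
definition sum_subspaces :: "nat \<Rightarrow> nat \<Rightarrow> (nat \<Rightarrow> real vec set) \<Rightarrow> real vec set" where
  "sum_subspaces n N W = {finsum_vec TYPE(real) n v {1..N} | v. \<forall>s \<in> {1..N}. v s \<in> W s}"

text \<open>A projection whose kernel and range are orthogonal in the \<open>A\<close>-inner product.\<close>
definition is_A_orth_projection :: "real mat \<Rightarrow> real mat \<Rightarrow> bool" where
  "is_A_orth_projection A P \<longleftrightarrow> P \<in> carrier_mat (dim_row A) (dim_row A) \<and> P * P = P \<and>
     (\<forall>x \<in> mat_kernel P. \<forall>y \<in> mat_range P. x \<bullet> (A *\<^sub>v y) = 0)"

definition op_H :: "nat \<Rightarrow> nat \<Rightarrow> (nat \<Rightarrow> real mat) \<Rightarrow> (nat \<Rightarrow> real mat) \<Rightarrow> real mat" where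
  "op_H n N R At =
     finsum (module_mat TYPE(real) n n) (\<lambda>s. transpose_mat (R s) * pinv (At s) * R s) {1..N}"

text \<open>\<open>At s\<close> is the spsd local matrix written A-tilde with index s; subdomains are numbered from 1.\<close>
definition local_setting ::
  "nat \<Rightarrow> nat \<Rightarrow> (nat \<Rightarrow> nat) \<Rightarrow> (nat \<Rightarrow> real mat) \<Rightarrow> (nat \<Rightarrow> real mat) \<Rightarrow> bool" where
  "local_setting n N ns R At \<longleftrightarrow>
     (\<forall>s \<in> {1..N}. R s \<in> carrier_mat (ns s) n \<and> At s \<in> carrier_mat (ns s) (ns s) \<and>
        R s * transpose_mat (R s) = 1\<^sub>m (ns s) \<and> spsd_mat (At s)) \<and>
     sum_subspaces n N (\<lambda>s. mat_range (transpose_mat (R s))) = carrier_vec n \<and>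
     invertible_mat (op_H n N R At)"

text \<open>A set of rows loses repetitions, but a basis consisting of the rows of a matrix with
  \<open>dim V0\<close> rows forces these rows to be pairwise distinct.\<close>
definition coarse_setting :: "nat \<Rightarrow> real vec set \<Rightarrow> real mat \<Rightarrow> bool" where
  "coarse_setting n V0 R0 \<longleftrightarrow>
     VectorSpace.subspace class_ring V0 (module_vec TYPE(real) n) \<and>
     R0 \<in> carrier_mat
       (vectorspace.dim class_ring (module_vec TYPE(real) n\<lparr>carrier := V0\<rparr>)) n \<and>
     vectorspace.basis class_ring (module_vec TYPE(real) n\<lparr>carrier := V0\<rparr>) (set (rows R0))"

definition op_P0 :: "real mat \<Rightarrow> real mat \<Rightarrow> real mat" where
  "op_P0 A R0 = 1\<^sub>m (dim_row A) -
     transpose_mat R0 * the (mat_inverse (R0 * A * transpose_mat R0)) * R0 * A"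

definition is_coloring ::
  "real mat \<Rightarrow> nat \<Rightarrow> (nat \<Rightarrow> nat) \<Rightarrow> (nat \<Rightarrow> real mat) \<Rightarrow> nat \<Rightarrow> (nat \<Rightarrow> nat set) \<Rightarrow> bool" where
  "is_coloring A N ns R Nc C \<longleftrightarrow>
     (\<forall>j \<in> {1..Nc}. C j \<subseteq> {1..N}) \<and> {1..N} = (\<Union>j \<in> {1..Nc}. C j) \<and>
     (\<forall>j \<in> {1..Nc}. \<forall>s \<in> C j. \<forall>t \<in> C j.
        s \<noteq> t \<longrightarrow> R s * A * transpose_mat (R t) = 0\<^sub>m (ns s) (ns t))"

definition is_coloring_constant ::
  "real mat \<Rightarrow> nat \<Rightarrow> (nat \<Rightarrow> nat) \<Rightarrow> (nat \<Rightarrow> real mat) \<Rightarrow> nat \<Rightarrow> bool" where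
  "is_coloring_constant A N ns R Nc \<longleftrightarrow> (\<exists>C. is_coloring A N ns R Nc C)"

text \<open>Meaningful for a non-empty square matrix all of whose complex eigenvalues are real.\<close>
definition largest_eigenvalue :: "real mat \<Rightarrow> real" where
  "largest_eigenvalue M = Max (spectrum M)"

definition has_real_spectrum :: "real mat \<Rightarrow> bool" where
  "has_real_spectrum M \<longleftrightarrow> spectrum M \<noteq> {} \<and> spectrum (map_mat complex_of_real M) \<subseteq> \<real>"

end

theory Submission
  imports Defs "Jordan_Normal_Form.DL_Rank"
begin

text \<open>Let \<open>v\<close> be an eigenvector of \<open>H A P\<^sub>0\<close> for \<open>l > 0\<close> and put \<open>z = P\<^sub>0 v\<close>,
  \<open>q = z \<bullet> A z\<close>, \<open>x\<^sub>s = pinv (At s) R\<^sub>s A z\<close> and \<open>y\<^sub>s = Pi\<^sub>s R\<^sub>s\<^sup>T x\<^sub>s\<close>. Since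
  \<open>R\<^sub>s\<^sup>T x\<^sub>s - y\<^sub>s\<close> lies in \<open>V0\<close>, which is \<open>A\<close>-orthogonal to \<open>z\<close>, both
  \<open>\<Sum>\<^sub>s z \<bullet> A y\<^sub>s\<close> and \<open>\<Sum>\<^sub>s x\<^sub>s \<bullet> At\<^sub>s x\<^sub>s\<close> equal \<open>l q\<close>. The vectors \<open>y\<^sub>s\<close> of one
  colour are pairwise \<open>A\<close>-orthogonal, so adding over the colours the squared norms of
  \<open>c z\<close> minus the sum of these \<open>y\<^sub>s\<close> gives \<open>0 \<le> Nc c\<^sup>2 q - 2 c l q + \<omega> l q\<close>;
  take \<open>c = l / Nc\<close>.\<close>

section \<open>Real vectors, symmetric forms and inverse matrices\<close>

lemma mult_mat_zero_vec:
  fixes M :: "'a :: semiring_0 mat"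
  assumes "M \<in> carrier_mat m n"
  shows "M *\<^sub>v 0\<^sub>v n = 0\<^sub>v m"
  by (intro eq_vecI) (use assms in \<open>auto simp: scalar_prod_def\<close>)

lemma scalar_prod_self_eq_0:
  fixes v :: "real vec"
  assumes "v \<in> carrier_vec n" "v \<bullet> v = 0"
  shows "v = 0\<^sub>v n"
proof (rule eq_vecI)
  show "dim_vec v = dim_vec (0\<^sub>v n :: real vec)" using assms by simp
  fix i assume "i < dim_vec (0\<^sub>v n :: real vec)"
  moreover have "\<forall>i\<in>{0..<n}. v $ i * v $ i = 0"
    using assms by (subst sum_nonneg_eq_0_iff[symmetric]) (auto simp: scalar_prod_def)
  ultimately show "v $ i = 0\<^sub>v n $ i" by auto
qed

text \<open>Makes the results on \<open>op_P0\<close> available for the Euclidean inner product, as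
  the construction of the pseudo-inverse requires.\<close>

lemma spd_one: "spd_mat (1\<^sub>m n)"
proof -
  have "x \<bullet> x \<ge> 0" for x :: "real vec" by (auto simp: scalar_prod_def intro: sum_nonneg)
  then show ?thesis
    unfolding spd_mat_def using scalar_prod_self_eq_0[of _ n] by (auto simp: less_le)
qed

lemma scalar_prod_sym_mat:
  fixes A :: "real mat"
  assumes "A \<in> carrier_mat n n" "transpose_mat A = A" "x \<in> carrier_vec n" "y \<in> carrier_vec n"
  shows "x \<bullet> (A *\<^sub>v y) = y \<bullet> (A *\<^sub>v x)"
  using transpose_vec_mult_scalar[OF assms(1,4,3)] assms
    comm_scalar_prod[of "A *\<^sub>v x" n y] by simp

lemma exists_inverse_mat:
  fixes M :: "real mat"
  assumes M: "M \<in> carrier_mat n n"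
    and inj: "\<And>v. v \<in> carrier_vec n \<Longrightarrow> M *\<^sub>v v = 0\<^sub>v n \<Longrightarrow> v = 0\<^sub>v n"
  obtains B where "mat_inverse M = Some B" "B \<in> carrier_mat n n" "M * B = 1\<^sub>m n" "B * M = 1\<^sub>m n"
proof -
  have "det M \<noteq> 0" using det_0_iff_vec_prod_zero_field[OF M] inj by blast
  then have "M \<in> Units (ring_mat TYPE(real) n ())" by (rule det_non_zero_imp_unit[OF M])
  then obtain B where B: "mat_inverse M = Some B" using mat_inverse(1)[OF M] by fastforce
  then show thesis using mat_inverse(2)[OF M B] that by blast
qed

lemma inverse_sym_mat:
  fixes M B :: "real mat"
  assumes M: "M \<in> carrier_mat n n" and B: "B \<in> carrier_mat n n"
    and MB: "M * B = 1\<^sub>m n" and BM: "B * M = 1\<^sub>m n" and sym: "transpose_mat M = M"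
  shows "transpose_mat B = B"
proof -
  have BtM: "transpose_mat B * M = 1\<^sub>m n"
    using transpose_mult[OF M B] MB sym by simp
  have "transpose_mat B = transpose_mat B * (M * B)" using B MB by simp
  also have "\<dots> = (transpose_mat B * M) * B" 
    using assoc_mult_mat[of "transpose_mat B" n n M n B n] M B by simp
  finally show ?thesis using BtM B by simp
qed

section \<open>The coarse space and its projection\<close>

text \<open>Translates the module-theoretic basis into matrix terms: spanning becomes a statement on
  the range of the transpose of \<open>R0\<close>, independence becomes injectivity of that
  transpose.\<close>

lemma coarse_settingD:
  assumes cs: "coarse_setting n V0 R0"
  shows "R0 \<in> carrier_mat (dim_row R0) n"
    and "mat_range (transpose_mat R0) = V0"
    and "\<And>c. c \<in> carrier_vec (dim_row R0) \<Longrightarrow> transpose_mat R0 *\<^sub>v c = 0\<^sub>v n \<Longrightarrow>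
      c = 0\<^sub>v (dim_row R0)"
proof -
  interpret vec_space "TYPE(real)" n .
  let ?W = "module_vec TYPE(real) n\<lparr>carrier := V0\<rparr>"
  have sub: "VectorSpace.subspace class_ring V0 V"
    and car: "R0 \<in> carrier_mat (vectorspace.dim class_ring ?W) n"
    and bas: "vectorspace.basis class_ring ?W (set (rows R0))"
    using cs unfolding coarse_setting_def by auto
  show R0: "R0 \<in> carrier_mat (dim_row R0) n" using car by auto
  have vsW: "vectorspace class_ring ?W" by (rule subspace_is_vs[OF sub])
  have subm: "submodule class_ring V0 V" using sub by simp
  note bd = bas[unfolded vectorspace.basis_def[OF vsW]]
  have inV0: "set (rows R0) \<subseteq> V0" using bd by simp
  note nd = span_li_not_depend[OF inV0 subm]
  have sp: "span (set (rows R0)) = V0" using bd nd(1) by simp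
  have li: "lin_indpt (set (rows R0))" using bd nd(2) by simp
  \<comment> \<open>The number of rows is the dimension, hence the size of the basis, so no row is
    repeated. Without this, independence of the set of rows would not give injectivity.\<close>
  have "card (set (rows R0)) = length (rows R0)"
    using vectorspace.dim_basis[OF vsW _ bas] car by simp
  then have dist: "distinct (rows R0)" by (rule card_distinct)
  show "mat_range (transpose_mat R0) = V0"
  proof -
    have "V0 = {w \<in> carrier_vec n. \<exists>y\<in>carrier_vec (dim_row R0). transpose_mat R0 *\<^sub>v y = w}"
      using row_space_eq[OF R0] sp carrier_matD(2)[OF R0] unfolding row_space_def by simp
    moreover have "transpose_mat R0 *\<^sub>v y \<in> carrier_vec n" for y
      using R0 by (intro carrier_vecI) simp
    ultimately show ?thesis unfolding mat_range_def by auto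
  qed
  fix c assume c: "c \<in> carrier_vec (dim_row R0)" "transpose_mat R0 *\<^sub>v c = 0\<^sub>v n"
  show "c = 0\<^sub>v (dim_row R0)"
  proof (rule ccontr)
    assume "c \<noteq> 0\<^sub>v (dim_row R0)"
    moreover have "transpose_mat R0 \<in> carrier_mat n (dim_row R0)"
      using R0 by (simp only: transpose_carrier_mat)
    moreover have "distinct (cols (transpose_mat R0))" using dist by (simp only: cols_transpose)
    ultimately have "lin_dep (set (cols (transpose_mat R0)))"
      using c lin_depI by blast
    then show False using li by (simp only: cols_transpose)
  qed
qed

text \<open>A basis of the kernel, listed as rows, turns the kernel of any matrix into a coarse
  space, so that \<open>op_P0\<close> can project along it.\<close>

lemma coarse_setting_mat_kernel:
  fixes M :: "real mat"
  assumes M: "M \<in> carrier_mat m n"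
  obtains R0 where "coarse_setting n (mat_kernel M) R0"
proof -
  interpret kernel m n M by (unfold_locales, rule M)
  obtain B where fin: "finite B" and bas: "basis B" using kernel_basis_exists[OF M] by auto
  obtain ws where ws: "set ws = B" "distinct ws" using finite_distinct_list[OF fin] by blast
  have BK: "B \<subseteq> mat_kernel M" using bas unfolding Ker.basis_def by simp
  then have Bc: "B \<subseteq> carrier_vec n" using mat_kernel_carrier[OF M] by blast
  have "submodule class_ring (mat_kernel M) NC.V"
    by (unfold_locales)
      (insert M mult_add_distrib_mat_vec[OF M] mult_mat_vec[OF M] mat_kernel[OF M],
        auto simp: class_ring_simps)
  then have sub: "VectorSpace.subspace class_ring (mat_kernel M) NC.V"
    by (intro VectorSpace.subspace.intro vec_vs)
  have "length ws = dim" using Ker.dim_basis[OF fin bas] distinct_card[OF ws(2)] ws(1) by simp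
  moreover have "rows (mat_of_rows n ws) = ws" using Bc ws by (intro rows_mat_of_rows) auto
  ultimately have "coarse_setting n (mat_kernel M) (mat_of_rows n ws)"
    unfolding coarse_setting_def using sub bas ws by auto
  then show thesis by (rule that)
qed

text \<open>With \<open>T\<close> the transpose of \<open>R0\<close> and \<open>B\<close> the
  inverse of the Gram matrix \<open>G = R0 A T\<close>, the operator is \<open>1 - Q A\<close> for
  the symmetric \<open>Q = T B R0\<close>. The second claim is its self-adjointness in the
  \<open>A\<close>-inner product.\<close>

lemma op_P0_props:
  assumes A: "A \<in> carrier_mat n n" and spd: "spd_mat A" and cs: "coarse_setting n V0 R0"
  shows "op_P0 A R0 \<in> carrier_mat n n"
    and "transpose_mat (op_P0 A R0) * A = A * op_P0 A R0"
    and "\<And>v. v \<in> V0 \<Longrightarrow> op_P0 A R0 *\<^sub>v v = 0\<^sub>v n"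
    and "\<And>x. x \<in> carrier_vec n \<Longrightarrow> x - op_P0 A R0 *\<^sub>v x \<in> V0"
proof -
  define m where "m = dim_row R0"
  define T where "T = transpose_mat R0"
  define G where "G = R0 * A * T"
  note cD = coarse_settingD[OF cs, folded m_def T_def]
  have R0: "R0 \<in> carrier_mat m n" by (rule cD(1))
  then have T: "T \<in> carrier_mat n m" by (simp add: T_def)
  have RA: "R0 * A \<in> carrier_mat m n" using R0 A by simp
  have G: "G \<in> carrier_mat m m" unfolding G_def using RA T by simp
  have symA: "transpose_mat A = A" using spd by (simp add: spd_mat_def)
  have symG: "transpose_mat G = G"
  proof -
    have "transpose_mat G = transpose_mat T * (transpose_mat A * transpose_mat R0)"
      unfolding G_def transpose_mult[OF RA T] transpose_mult[OF R0 A] ..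
    also have "\<dots> = R0 * (A * T)" unfolding symA by (simp add: T_def)
    also have "\<dots> = G" unfolding G_def using assoc_mult_mat[OF R0 A T] by simp
    finally show ?thesis .
  qed
  \<comment> \<open>Since \<open>c \<bullet> G c\<close> is the squared \<open>A\<close>-norm of
    \<open>T c\<close>, definiteness forces \<open>T c = 0\<close>, and \<open>T\<close> is
    injective.\<close>
  have "c = 0\<^sub>v m" if c: "c \<in> carrier_vec m" and Gc: "G *\<^sub>v c = 0\<^sub>v m" for c
  proof -
    have Tc: "T *\<^sub>v c \<in> carrier_vec n" using T c by simp
    have "G *\<^sub>v c = R0 *\<^sub>v (A *\<^sub>v (T *\<^sub>v c))"
      unfolding G_def using assoc_mult_mat_vec[OF RA T c] assoc_mult_mat_vec[OF R0 A Tc] by simp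
    then have "(T *\<^sub>v c) \<bullet> (A *\<^sub>v (T *\<^sub>v c)) = c \<bullet> (G *\<^sub>v c)"
      unfolding T_def using transpose_vec_mult_scalar[OF R0 _ c] Tc A by (simp add: T_def)
    also have "\<dots> = 0" using Gc c by simp
    finally have "T *\<^sub>v c = 0\<^sub>v n"
      using spd A Tc unfolding spd_mat_def by fastforce
    then show ?thesis using cD(3) c by blast
  qed
  then obtain B where inv: "mat_inverse G = Some B" and B: "B \<in> carrier_mat m m"
    and GB: "G * B = 1\<^sub>m m" and BG: "B * G = 1\<^sub>m m"
    using exists_inverse_mat[OF G] by metis
  have symB: "transpose_mat B = B" by (rule inverse_sym_mat[OF G B GB BG symG])
  define Q where "Q = T * B * R0"
  have TB: "T * B \<in> carrier_mat n m" using T B by simp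
  have Q: "Q \<in> carrier_mat n n" unfolding Q_def using TB R0 by simp
  have QA: "Q * A \<in> carrier_mat n n" using Q A by simp
  have symQ: "transpose_mat Q = Q"
  proof -
    have "transpose_mat Q = T * (B * R0)"
      unfolding Q_def transpose_mult[OF TB R0] transpose_mult[OF T B] symB by (simp add: T_def)
    also have "\<dots> = Q" unfolding Q_def using assoc_mult_mat[OF T B R0] by simp
    finally show ?thesis .
  qed
  have P: "op_P0 A R0 = 1\<^sub>m n - Q * A"
    using A inv unfolding op_P0_def Q_def G_def T_def by simp
  show carP: "op_P0 A R0 \<in> carrier_mat n n" unfolding P using QA by (simp add: minus_carrier_mat)
  have "transpose_mat (op_P0 A R0) = 1\<^sub>m n - A * Q"
    unfolding P using transpose_minus[OF one_carrier_mat QA] transpose_mult[OF Q A] symA symQ by simp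
  \<comment> \<open>Both sides expand to \<open>A - A Q A\<close>.\<close>
  then show "transpose_mat (op_P0 A R0) * A = A * op_P0 A R0"
    unfolding P using minus_mult_distrib_mat[OF one_carrier_mat _ A, of "A * Q"]
      mult_minus_distrib_mat[OF A one_carrier_mat QA] assoc_mult_mat[OF A Q A] A Q by simp
  have Pv: "op_P0 A R0 *\<^sub>v v = v - Q *\<^sub>v (A *\<^sub>v v)" if "v \<in> carrier_vec n" for v
    unfolding P using that Q A QA by (simp add: minus_mult_distrib_mat_vec[of _ n n])
  have Qv: "Q *\<^sub>v w = T *\<^sub>v (B *\<^sub>v (R0 *\<^sub>v w))" if "w \<in> carrier_vec n" for w
    unfolding Q_def using that T B R0 TB
    by (simp add: assoc_mult_mat_vec[of _ n m _ n] assoc_mult_mat_vec[of _ n m _ m])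
  show "op_P0 A R0 *\<^sub>v v = 0\<^sub>v n" if v0: "v \<in> V0" for v
  proof -
    obtain c where c: "c \<in> carrier_vec m" and v: "v = T *\<^sub>v c"
      using v0 cD(2) T unfolding mat_range_def by auto
    have vc: "v \<in> carrier_vec n" unfolding v using T c by simp
    \<comment> \<open>On \<open>v = T c\<close> the inverse Gram matrix cancels:
      \<open>Q A v = T B G c = T c = v\<close>.\<close>
    have "R0 *\<^sub>v (A *\<^sub>v v) = G *\<^sub>v c"
      unfolding G_def v using assoc_mult_mat_vec[OF RA T c] assoc_mult_mat_vec[OF R0 A, of "T *\<^sub>v c"] T c
      by simp
    moreover have "B *\<^sub>v (G *\<^sub>v c) = c"
      using assoc_mult_mat_vec[OF B G c] BG c by simp
    ultimately show ?thesis using Pv[OF vc] Qv[of "A *\<^sub>v v"] A vc v by simp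
  qed
  show "x - op_P0 A R0 *\<^sub>v x \<in> V0" if x: "x \<in> carrier_vec n" for x
  proof -
    have Ax: "A *\<^sub>v x \<in> carrier_vec n" using A x by simp
    have QAx: "Q *\<^sub>v (A *\<^sub>v x) \<in> carrier_vec n" using Q Ax by simp
    have "x - op_P0 A R0 *\<^sub>v x = Q *\<^sub>v (A *\<^sub>v x)"
      unfolding Pv[OF x] using x QAx by (intro eq_vecI) auto
    also have "\<dots> = T *\<^sub>v (B *\<^sub>v (R0 *\<^sub>v (A *\<^sub>v x)))" by (rule Qv[OF Ax])
    also have "\<dots> \<in> mat_range T"
      unfolding mat_range_def using T B R0 Ax by auto
    finally show ?thesis using cD(2) by simp
  qed
qed

section \<open>The Moore-Penrose inverse of a symmetric matrix\<close>

text \<open>\<open>M B = (M C) (M B)\<close> has symmetric factors and a symmetric product, so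
  transposing swaps the factors and yields \<open>M B = M C\<close>; likewise
  \<open>C M = B M\<close>. Then \<open>B = B M B = B M C = C M C = C\<close>.\<close>

lemma moore_penrose_unique:
  assumes "is_moore_penrose M B" "is_moore_penrose M C"
  shows "B = C"
proof -
  define r c where "r = dim_row M" and "c = dim_col M"
  have M: "M \<in> carrier_mat r c" by (simp add: r_def c_def)
  have B: "B \<in> carrier_mat c r" "M * B * M = M" "B * M * B = B"
    "transpose_mat (M * B) = M * B" "transpose_mat (B * M) = B * M"
    and C: "C \<in> carrier_mat c r" "M * C * M = M" "C * M * C = C"
    "transpose_mat (M * C) = M * C" "transpose_mat (C * M) = C * M"
    using assms unfolding is_moore_penrose_def r_def c_def by auto
  have cr: "M * B \<in> carrier_mat r r" "M * C \<in> carrier_mat r r"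
    "B * M \<in> carrier_mat c c" "C * M \<in> carrier_mat c c" using M B(1) C(1) by auto
  have "M * B = M * C * M * B" by (simp only: C(2))
  also have "\<dots> = (M * C) * (M * B)" by (rule assoc_mult_mat[OF cr(2) M B(1)])
  finally have "transpose_mat (M * B) = transpose_mat ((M * C) * (M * B))" by simp
  also have "\<dots> = (M * B) * (M * C)" by (simp only: transpose_mult[OF cr(2,1)] B(4) C(4))
  also have "\<dots> = M * B * M * C" by (rule assoc_mult_mat[OF cr(1) M C(1), symmetric])
  finally have 1: "M * B = M * C" by (simp only: B)
  have "C * M = C * (M * B * M)" by (simp only: B(2))
  also have "M * B * M = M * (B * M)" by (rule assoc_mult_mat[OF M B(1) M])
  also have "C * (M * (B * M)) = (C * M) * (B * M)" by (rule assoc_mult_mat[OF C(1) M cr(3), symmetric])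
  finally have "transpose_mat (C * M) = transpose_mat ((C * M) * (B * M))" by simp
  also have "\<dots> = (B * M) * (C * M)" by (simp only: transpose_mult[OF cr(4,3)] B(5) C(5))
  also have "\<dots> = B * (M * (C * M))" by (rule assoc_mult_mat[OF B(1) M cr(4)])
  also have "M * (C * M) = M * C * M" by (rule assoc_mult_mat[OF M C(1) M, symmetric])
  finally have 2: "C * M = B * M" by (simp only: C)
  have "B = B * M * B" by (simp only: B(3))
  also have "\<dots> = B * (M * B)" by (rule assoc_mult_mat[OF B(1) M B(1)])
  also have "\<dots> = B * M * C" unfolding 1 by (rule assoc_mult_mat[OF B(1) M C(1), symmetric])
  also have "\<dots> = C" unfolding 2[symmetric] by (rule C(3))
  finally show ?thesis .
qed

text \<open>With \<open>P\<close> the orthogonal projection along the kernel, \<open>K = M + (1 - P)\<close> is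
  invertible and \<open>K\<^sup>-\<^sup>1 P\<close> is the pseudo-inverse. Taking \<open>A = 1\<close> in \<open>op_P0\<close> provides \<open>P\<close>.\<close>
lemma moore_penrose_exists_sym:
  assumes M: "M \<in> carrier_mat n n" and sym: "transpose_mat M = M"
  shows "\<exists>B. is_moore_penrose M B"
proof -
  obtain R0 where cs: "coarse_setting n (mat_kernel M) R0"
    using coarse_setting_mat_kernel[OF M] .
  define P where "P = op_P0 (1\<^sub>m n) R0"
  note Pp = op_P0_props[OF one_carrier_mat spd_one cs, folded P_def]
  have P: "P \<in> carrier_mat n n" by (rule Pp(1))
  have symP: "transpose_mat P = P" using Pp(2) P by simp
  have Pv: "P *\<^sub>v x \<in> carrier_vec n" if "x \<in> carrier_vec n" for x using P that by simp
  have fix_vec: "M *\<^sub>v (P *\<^sub>v x) = M *\<^sub>v x" "P *\<^sub>v (P *\<^sub>v x) = P *\<^sub>v x"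
    if x: "x \<in> carrier_vec n" for x
  \<comment> \<open>The vector \<open>x - P x\<close> lies in the kernel of \<open>M\<close>, where
    both \<open>M\<close> and \<open>P\<close> vanish.\<close>
  proof -
    note k = Pp(4)[OF x]
    have "M *\<^sub>v (x - P *\<^sub>v x) = 0\<^sub>v n" by (rule mat_kernelD(2)[OF M k])
    then have a: "M *\<^sub>v x - M *\<^sub>v (P *\<^sub>v x) = 0\<^sub>v n"
      using mult_minus_distrib_mat_vec[OF M x Pv[OF x]] by simp
    have b: "P *\<^sub>v x - P *\<^sub>v (P *\<^sub>v x) = 0\<^sub>v n"
      using mult_minus_distrib_mat_vec[OF P x Pv[OF x]] Pp(3)[OF k] by simp
    have zeroD: "v = u" if "u - v = 0\<^sub>v n" "u \<in> carrier_vec n" "v \<in> carrier_vec n" for u v :: "real vec"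
    proof (rule eq_vecI)
      fix i assume "i < dim_vec u"
      then show "v $ i = u $ i"
        using arg_cong[OF that(1), of "\<lambda>w. w $ i"] that(2,3) by simp
    qed (use that in simp)
    show "M *\<^sub>v (P *\<^sub>v x) = M *\<^sub>v x"
      by (rule zeroD[OF a]) (use M x Pv in simp_all)
    show "P *\<^sub>v (P *\<^sub>v x) = P *\<^sub>v x"
      by (rule zeroD[OF b]) (use P x Pv in simp_all)
  qed
  have mat_eq: "X = Y" if "X \<in> carrier_mat n n" "Y \<in> carrier_mat n n"
    "\<And>x. x \<in> carrier_vec n \<Longrightarrow> X *\<^sub>v x = Y *\<^sub>v x" for X Y :: "real mat"
  proof (rule eq_matI)
    fix i j assume "i < dim_row Y" "j < dim_col Y"
    then show "X $$ (i, j) = Y $$ (i, j)"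
      using arg_cong[OF that(3)[of "unit_vec n j"], of "\<lambda>w. w $ i"] that(1,2) by simp
  qed (use that in simp_all)
  have MP: "M * P = M"
    by (rule mat_eq) (use M P fix_vec(1) in simp_all)
  have PP: "P * P = P"
    by (rule mat_eq) (use P fix_vec(2) in simp_all)
  have PM: "P * M = M"
    using transpose_mult[OF M P] MP sym symP by simp
  define K where "K = M + (1\<^sub>m n - P)"
  have IP: "1\<^sub>m n - P \<in> carrier_mat n n" using P by (simp add: minus_carrier_mat)
  have K: "K \<in> carrier_mat n n" unfolding K_def using M IP by simp
  have IPP: "(1\<^sub>m n - P) * P = 0\<^sub>m n n" "P * (1\<^sub>m n - P) = 0\<^sub>m n n"
    using minus_mult_distrib_mat[OF one_carrier_mat P P] mult_minus_distrib_mat[OF P one_carrier_mat P] P PP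
    by simp_all
  have KP: "K * P = M"
    unfolding K_def add_mult_distrib_mat[OF M IP P] IPP MP using M by simp
  have PK: "P * K = M"
    unfolding K_def mult_add_distrib_mat[OF P M IP] IPP PM using M by simp
  \<comment> \<open>Applying \<open>P\<close> to \<open>K v = 0\<close> gives
    \<open>M v = 0\<close>, hence \<open>P v = 0\<close>; then \<open>K v\<close> reduces to
    \<open>v\<close> itself.\<close>
  have "v = 0\<^sub>v n" if v: "v \<in> carrier_vec n" and Kv: "K *\<^sub>v v = 0\<^sub>v n" for v
  proof -
    have Mv: "M *\<^sub>v v = 0\<^sub>v n"
      using arg_cong[OF Kv, of "\<lambda>x. P *\<^sub>v x"] assoc_mult_mat_vec[OF P K v] PK P
      by (simp add: mult_mat_zero_vec)
    then have "P *\<^sub>v v = 0\<^sub>v n" using Pp(3) mat_kernelI[OF M v] by blast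
    then have "K *\<^sub>v v = 0\<^sub>v n + (v - 0\<^sub>v n)"
      unfolding K_def using add_mult_distrib_mat_vec[OF M IP v] Mv
        minus_mult_distrib_mat_vec[OF one_carrier_mat P v] v by simp
    then show ?thesis using Kv v by simp
  qed
  then obtain L where L: "L \<in> carrier_mat n n" "K * L = 1\<^sub>m n" "L * K = 1\<^sub>m n"
    using exists_inverse_mat[OF K] by metis
  have L_M: "L * M = P"
    using assoc_mult_mat[OF L(1) K P] KP L P by simp
  have M_L: "M * L = P"
    using assoc_mult_mat[OF P K L(1)] PK L P by simp
  define B where "B = L * P"
  have B: "B \<in> carrier_mat n n" unfolding B_def using L P by simp
  have MB: "M * B = P"
    unfolding B_def using assoc_mult_mat[OF M L(1) P] M_L PP by simp
  have BM: "B * M = P"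
    unfolding B_def using assoc_mult_mat[OF L(1) P M] L_M PM by simp
  have "P * B = B"
  proof -
    \<comment> \<open>\<open>L M\<close> and \<open>M L\<close> are both \<open>P\<close>, so
      \<open>P\<close> commutes with \<open>L\<close>.\<close>
    have "P * L = L * M * L" by (simp only: L_M)
    also have "\<dots> = L * P" using assoc_mult_mat[OF L(1) M L(1)] M_L by simp
    finally show ?thesis unfolding B_def
      using assoc_mult_mat[OF P L(1) P, symmetric] assoc_mult_mat[OF L(1) P P] PP by simp
  qed
  then have "is_moore_penrose M B"
    unfolding is_moore_penrose_def using M B MB BM PM symP by simp
  then show ?thesis ..
qed

text \<open>Existence and uniqueness give the description in \<open>pinv\<close> its meaning.
  Transposing the Penrose equations of a symmetric \<open>M\<close> shows that the transposed
  pseudo-inverse solves them too, so uniqueness makes the pseudo-inverse symmetric.\<close>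

lemma pinv_sym_props:
  assumes M: "M \<in> carrier_mat n n" and sym: "transpose_mat M = M"
  shows "pinv M \<in> carrier_mat n n" "pinv M * M * pinv M = pinv M" "transpose_mat (pinv M) = pinv M"
proof -
  have mp: "is_moore_penrose M (pinv M)"
    unfolding pinv_def using moore_penrose_exists_sym[OF M sym] moore_penrose_unique
    by (metis (no_types, lifting) theI')
  note mpD = mp[unfolded is_moore_penrose_def]
  show B: "pinv M \<in> carrier_mat n n" using mpD M by simp
  show "pinv M * M * pinv M = pinv M" using mpD by simp
  have tr: "transpose_mat (X * Y) = transpose_mat Y * transpose_mat X"
    if "X \<in> carrier_mat n n" "Y \<in> carrier_mat n n" for X Y :: "real mat"
    using transpose_mult[OF that] .
  let ?B = "transpose_mat (pinv M)"
  have Bt: "?B \<in> carrier_mat n n" using B by simp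
  have 1: "M * ?B = pinv M * M" "?B * M = M * pinv M"
    using mpD tr[OF B M] tr[OF M B] sym by simp_all
  have "transpose_mat (M * pinv M * M) = transpose_mat M" using mpD by simp
  then have 2: "M * (?B * M) = M" using tr[of "M * pinv M" M] tr[OF M B] M B sym by simp
  have "transpose_mat (pinv M * M * pinv M) = ?B" using mpD by simp
  then have 3: "?B * (M * ?B) = ?B" using tr[of "pinv M * M" "pinv M"] tr[OF B M] M B sym by simp
  have "is_moore_penrose M ?B"
    unfolding is_moore_penrose_def
    using 1 2 3 Bt M mpD assoc_mult_mat[OF M Bt M] assoc_mult_mat[OF Bt M Bt] by simp
  then show "?B = pinv M" using mp by (rule moore_penrose_unique)
qed

section \<open>Reality of the spectrum\<close>

text \<open>The form \<open>x \<bullet> S y\<close> makes \<open>H S\<close> self-adjoint. Writing an eigenvector for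
  \<open>a + \<i> b\<close> as \<open>x + \<i> y\<close> with real \<open>x\<close> and \<open>y\<close>, self-adjointness gives
  \<open>b (x \<bullet> S x + y \<bullet> S y) = 0\<close>.\<close>
lemma real_spectrum_sym_mult_spsd:
  fixes H S :: "real mat"
  assumes H: "H \<in> carrier_mat n n" and S: "S \<in> carrier_mat n n"
    and symH: "\<And>x y. x \<in> carrier_vec n \<Longrightarrow> y \<in> carrier_vec n \<Longrightarrow> x \<bullet> (H *\<^sub>v y) = y \<bullet> (H *\<^sub>v x)"
    and symS: "transpose_mat S = S"
    and nonneg: "\<And>x. x \<in> carrier_vec n \<Longrightarrow> 0 \<le> x \<bullet> (S *\<^sub>v x)"
    and definite: "\<And>x. x \<in> carrier_vec n \<Longrightarrow> x \<bullet> (S *\<^sub>v x) = 0 \<Longrightarrow> S *\<^sub>v x = 0\<^sub>v n"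
  shows "spectrum (map_mat complex_of_real (H * S)) \<subseteq> \<real>"
proof
  fix ev assume ev_in: "ev \<in> spectrum (map_mat complex_of_real (H * S))"
  define M where "M = H * S"
  have M: "M \<in> carrier_mat n n" unfolding M_def using H S by simp
  have Mv: "M *\<^sub>v v = H *\<^sub>v (S *\<^sub>v v)" if "v \<in> carrier_vec n" for v
    unfolding M_def by (rule assoc_mult_mat_vec[OF H S that])
  obtain v where v: "v \<in> carrier_vec n" "v \<noteq> 0\<^sub>v n"
    and vev: "map_mat complex_of_real M *\<^sub>v v = ev \<cdot>\<^sub>v v"
    using ev_in M unfolding spectrum_def eigenvalue_def eigenvector_def M_def[symmetric] by auto
  define a b x y where "a = Re ev" and "b = Im ev" and "x = map_vec Re v" and "y = map_vec Im v"
  have x: "x \<in> carrier_vec n" and y: "y \<in> carrier_vec n" using v by (simp_all add: x_def y_def)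
  have ent: "(map_mat complex_of_real M *\<^sub>v v) $ i = ev * v $ i" if "i < n" for i
    using vev that v by simp
  have sm: "(map_mat complex_of_real M *\<^sub>v v) $ i = (\<Sum>j = 0..<n. complex_of_real (M $$ (i, j)) * v $ j)"
    if "i < n" for i
    using that M v by (simp add: scalar_prod_def)
  have Mx: "M *\<^sub>v x = a \<cdot>\<^sub>v x - b \<cdot>\<^sub>v y"
  proof (rule eq_vecI)
    fix i assume "i < dim_vec (a \<cdot>\<^sub>v x - b \<cdot>\<^sub>v y)"
    then have i: "i < n" using y by simp
    show "(M *\<^sub>v x) $ i = (a \<cdot>\<^sub>v x - b \<cdot>\<^sub>v y) $ i"
      using arg_cong[OF ent[OF i], of Re] sm[OF i] i M v
      by (simp add: a_def b_def x_def y_def scalar_prod_def)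
  qed (use M y in simp)
  have My: "M *\<^sub>v y = a \<cdot>\<^sub>v y + b \<cdot>\<^sub>v x"
  proof (rule eq_vecI)
    fix i assume "i < dim_vec (a \<cdot>\<^sub>v y + b \<cdot>\<^sub>v x)"
    then have i: "i < n" using x by simp
    show "(M *\<^sub>v y) $ i = (a \<cdot>\<^sub>v y + b \<cdot>\<^sub>v x) $ i"
      using arg_cong[OF ent[OF i], of Im] sm[OF i] i M v
      by (simp add: a_def b_def x_def y_def scalar_prod_def)
  qed (use M x in simp)
  define s where "s u w = u \<bullet> (S *\<^sub>v w)" for u w
  have s_sym: "s u w = s w u" if "u \<in> carrier_vec n" "w \<in> carrier_vec n" for u w
    unfolding s_def by (rule scalar_prod_sym_mat[OF S symS that])
  have Sv: "S *\<^sub>v u \<in> carrier_vec n" if "u \<in> carrier_vec n" for u using S that by simp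
  have s_alt: "s u w = (S *\<^sub>v u) \<bullet> w" if "u \<in> carrier_vec n" "w \<in> carrier_vec n" for u w
    using s_sym[OF that] comm_scalar_prod[OF that(2) Sv[OF that(1)]] by (simp add: s_def)
  \<comment> \<open>Both sides pair \<open>S x\<close> with \<open>S y\<close> through the symmetric
    \<open>H\<close>. Inserting \<open>Mx\<close> and \<open>My\<close> cancels the terms with
    \<open>a\<close> and leaves those with \<open>b\<close>.\<close>
  have "s x (M *\<^sub>v y) = s y (M *\<^sub>v x)"
    using symH[OF Sv[OF x] Sv[OF y]] H Sv x y by (simp add: s_alt Mv)
  then have "b * (s x x + s y y) = 0"
    using x y s_sym[OF x y] Sv[OF x] Sv[OF y] unfolding Mx My
    by (simp add: s_alt scalar_prod_add_distrib[of _ n] scalar_prod_minus_distrib[of _ n] algebra_simps)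
  then consider "b = 0" | "s x x = 0" "s y y = 0"
    using nonneg[OF x] nonneg[OF y] unfolding s_def by fastforce
  then show "ev \<in> \<real>"
  proof cases
    case 1
    then show ?thesis by (simp add: b_def complex_is_Real_iff)
  next
    \<comment> \<open>If the form vanishes on \<open>x\<close> and on \<open>y\<close>, then
      \<open>S\<close>, hence \<open>M\<close>, kills both, so \<open>ev\<close> times the nonzero
      \<open>v\<close> is zero.\<close>
    case 2
    have "M *\<^sub>v x = 0\<^sub>v n" "M *\<^sub>v y = 0\<^sub>v n"
      using definite[OF x] definite[OF y] 2 H x y by (auto simp: s_def Mv mult_mat_zero_vec)
    then have ab: "a \<cdot>\<^sub>v x - b \<cdot>\<^sub>v y = 0\<^sub>v n" "a \<cdot>\<^sub>v y + b \<cdot>\<^sub>v x = 0\<^sub>v n" using Mx My by simp_all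
    have "ev * v $ i = 0" if i: "i < n" for i
      using arg_cong[OF ab(1), of "\<lambda>w. w $ i"] arg_cong[OF ab(2), of "\<lambda>w. w $ i"] i v
      by (intro complex_eqI) (simp_all add: a_def b_def x_def y_def)
    moreover obtain i where "i < n" "v $ i \<noteq> 0" using v by (metis carrier_vecD eq_vecI index_zero_vec)
    ultimately have "ev = 0" by auto
    then show ?thesis by simp
  qed
qed

text \<open>A positive dimension provides a complex eigenvalue, which is real by assumption. It is a
  root of the characteristic polynomial of \<open>M\<close>, whose coefficients are real, so
  \<open>M\<close> has a real eigenvalue.\<close>

lemma has_real_spectrumI:
  fixes M :: "real mat"
  assumes M: "M \<in> carrier_mat n n" and n: "n > 0"
    and real: "spectrum (map_mat complex_of_real M) \<subseteq> \<real>"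
  shows "has_real_spectrum M"
proof -
  have Mc: "map_mat complex_of_real M \<in> carrier_mat n n" using M by simp
  obtain l where l: "l \<in> spectrum (map_mat complex_of_real M)"
    using spectrum_non_empty[OF Mc] n by auto
  then obtain r where r: "l = complex_of_real r" using real by (auto elim: Reals_cases)
  have cp: "char_poly (map_mat complex_of_real M) = map_poly complex_of_real (char_poly M)"
    by (rule of_real_hom.char_poly_hom[OF M])
  have "poly (char_poly (map_mat complex_of_real M)) (complex_of_real r) = 0"
    using l spectrum_root_char_poly[OF Mc] r by simp
  then have "complex_of_real (poly (char_poly M) r) = 0"
    unfolding cp of_real_hom.poly_map_poly .
  then have "poly (char_poly M) r = 0" by simp
  then show ?thesis
    using real spectrum_root_char_poly[OF M] unfolding has_real_spectrum_def by blast
qed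

section \<open>Quadratic form inequalities for coloured families\<close>

text \<open>The expression is the squared \<open>A\<close>-norm of \<open>z\<close> minus the sum of
  all \<open>y s\<close>. Replacing \<open>z\<close> by \<open>z - y u\<close> in the induction
  removes one vector at a time and avoids forming the vector sum.\<close>

lemma sum_form_orthogonal_nonneg:
  fixes A :: "real mat" and y :: "'i \<Rightarrow> real vec"
  assumes A: "A \<in> carrier_mat n n" and spsd: "spsd_mat A" and fin: "finite S"
    and y: "\<And>s. s \<in> S \<Longrightarrow> y s \<in> carrier_vec n"
    and orth: "\<And>s t. s \<in> S \<Longrightarrow> t \<in> S \<Longrightarrow> s \<noteq> t \<Longrightarrow> y s \<bullet> (A *\<^sub>v y t) = 0"
    and z: "z \<in> carrier_vec n"
  shows "0 \<le> z \<bullet> (A *\<^sub>v z) - 2 * (\<Sum>s\<in>S. z \<bullet> (A *\<^sub>v y s)) + (\<Sum>s\<in>S. y s \<bullet> (A *\<^sub>v y s))"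
  using fin y orth z
proof (induction S arbitrary: z rule: finite_induct)
  case empty
  then show ?case using spsd A by (simp add: spsd_mat_def)
next
  case (insert u S)
  have symA: "transpose_mat A = A" using spsd by (simp add: spsd_mat_def)
  have yu: "y u \<in> carrier_vec n" using insert by simp
  have z: "z \<in> carrier_vec n" by fact
  have Aw: "A *\<^sub>v w \<in> carrier_vec n" if "w \<in> carrier_vec n" for w using A that by simp
  have q: "(z - y u) \<bullet> (A *\<^sub>v (z - y u)) = z \<bullet> (A *\<^sub>v z) - 2 * (z \<bullet> (A *\<^sub>v y u)) + y u \<bullet> (A *\<^sub>v y u)"
    using z yu Aw[OF z] Aw[OF yu] scalar_prod_sym_mat[OF A symA z yu]
    by (simp add: mult_minus_distrib_mat_vec[OF A z yu] minus_scalar_prod_distrib[of _ n]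
        scalar_prod_minus_distrib[of _ n])
  \<comment> \<open>The cross terms are unaffected by the shift because \<open>y u\<close> is
    \<open>A\<close>-orthogonal to the other vectors.\<close>
  have l: "(z - y u) \<bullet> (A *\<^sub>v y s) = z \<bullet> (A *\<^sub>v y s)" if s: "s \<in> S" for s
  proof -
    have "y u \<bullet> (A *\<^sub>v y s) = 0" using insert.prems(2)[of u s] insert.hyps s by auto
    then show ?thesis
      using minus_scalar_prod_distrib[OF z yu Aw[of "y s"]] insert.prems(1) s by simp
  qed
  have "0 \<le> (z - y u) \<bullet> (A *\<^sub>v (z - y u)) - 2 * (\<Sum>s\<in>S. (z - y u) \<bullet> (A *\<^sub>v y s))
      + (\<Sum>s\<in>S. y s \<bullet> (A *\<^sub>v y s))"
    by (rule insert.IH) (use insert.prems z yu in auto)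
  then show ?case using insert.hyps by (simp add: q l cong: sum.cong)
qed

text \<open>Colour classes may overlap, so each index chooses one class containing it; the groups
  are then disjoint and exhaust \<open>S\<close>. The term in \<open>z\<close> occurs once per
  colour, which produces the factor \<open>Nc\<close>.\<close>

lemma sum_form_coloring_nonneg:
  fixes A :: "real mat" and y :: "'i \<Rightarrow> real vec"
  assumes A: "A \<in> carrier_mat n n" and spsd: "spsd_mat A" and fin: "finite S"
    and y: "\<And>s. s \<in> S \<Longrightarrow> y s \<in> carrier_vec n"
    and cover: "S \<subseteq> (\<Union>j\<in>{1..Nc::nat}. C j)"
    and orth: "\<And>j s t. j \<in> {1..Nc} \<Longrightarrow> s \<in> C j \<inter> S \<Longrightarrow> t \<in> C j \<inter> S \<Longrightarrow> s \<noteq> t \<Longrightarrow>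
      y s \<bullet> (A *\<^sub>v y t) = 0"
    and z: "z \<in> carrier_vec n"
  shows "0 \<le> real Nc * (z \<bullet> (A *\<^sub>v z)) - 2 * (\<Sum>s\<in>S. z \<bullet> (A *\<^sub>v y s)) + (\<Sum>s\<in>S. y s \<bullet> (A *\<^sub>v y s))"
proof -
  obtain c where c: "\<And>s. s \<in> S \<Longrightarrow> c s \<in> {1..Nc} \<and> s \<in> C (c s)"
    using cover by (metis UN_E subsetD)
  define D where "D j = {s \<in> S. c s = j}" for j
  have grp: "(\<Sum>j\<in>{1..Nc}. \<Sum>s\<in>D j. f s) = sum f S" for f :: "'i \<Rightarrow> real"
    unfolding D_def by (rule sum.group[OF fin]) (use c in auto)
  have "0 \<le> z \<bullet> (A *\<^sub>v z) - 2 * (\<Sum>s\<in>D j. z \<bullet> (A *\<^sub>v y s)) + (\<Sum>s\<in>D j. y s \<bullet> (A *\<^sub>v y s))"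
    if j: "j \<in> {1..Nc}" for j
  proof (rule sum_form_orthogonal_nonneg[OF A spsd])
    show "y s \<bullet> (A *\<^sub>v y t) = 0" if "s \<in> D j" "t \<in> D j" "s \<noteq> t" for s t
    proof (rule orth[OF j])
      show "s \<in> C j \<inter> S" "t \<in> C j \<inter> S" using that c[of s] c[of t] unfolding D_def by auto
    qed (rule that(3))
  qed (use fin y z in \<open>auto simp: D_def\<close>)
  then have "0 \<le> (\<Sum>j\<in>{1..Nc}. z \<bullet> (A *\<^sub>v z) - 2 * (\<Sum>s\<in>D j. z \<bullet> (A *\<^sub>v y s))
      + (\<Sum>s\<in>D j. y s \<bullet> (A *\<^sub>v y s)))"
    by (intro sum_nonneg)
  then show ?thesis
    by (simp only: sum.distrib sum_subtractf grp sum_distrib_left[symmetric]) simp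
qed

section \<open>The operator \<open>H\<close> as a bilinear form\<close>

text \<open>Testing against pairs of vectors turns the abstract sum in the matrix module into an
  ordinary real sum. The same induction proves closure, which the distributive laws require.\<close>

lemma finsum_module_mat:
  fixes f :: "'i \<Rightarrow> real mat"
  assumes finS: "finite S" and fS: "\<And>s. s \<in> S \<Longrightarrow> f s \<in> carrier_mat n n"
  shows "finsum (module_mat TYPE(real) n n) f S \<in> carrier_mat n n"
    and "u \<in> carrier_vec n \<Longrightarrow> w \<in> carrier_vec n \<Longrightarrow>
      u \<bullet> (finsum (module_mat TYPE(real) n n) f S *\<^sub>v w) = (\<Sum>s\<in>S. u \<bullet> (f s *\<^sub>v w))"
proof -
  interpret matrix_vs n n "TYPE(real)" .
  have "finsum V f S \<in> carrier_mat n n \<and> (\<forall>u\<in>carrier_vec n. \<forall>w\<in>carrier_vec n.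
      u \<bullet> (finsum V f S *\<^sub>v w) = (\<Sum>s\<in>S. u \<bullet> (f s *\<^sub>v w)))"
    using finS fS
  proof (induction S rule: finite_induct)
    case empty
    have "0\<^sub>m n n *\<^sub>v w = 0\<^sub>v n" if "w \<in> carrier_vec n" for w :: "real vec"
      using that by (intro eq_vecI) auto
    then show ?case by simp
  next
    case (insert s S)
    have fs: "f s \<in> carrier_mat n n" and fc: "f \<in> S \<rightarrow> carrier_mat n n" using insert by auto
    have IH: "finsum V f S \<in> carrier_mat n n" "\<forall>u\<in>carrier_vec n. \<forall>w\<in>carrier_vec n.
      u \<bullet> (finsum V f S *\<^sub>v w) = (\<Sum>s\<in>S. u \<bullet> (f s *\<^sub>v w))"
      using insert by auto
    have eq: "finsum V f (insert s S) = f s + finsum V f S"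
      using finsum_insert[OF insert.hyps(1,2) fc fs] .
    show ?case unfolding eq
      using IH fs insert.hyps
      by (auto simp: add_mult_distrib_mat_vec[of _ n n] scalar_prod_add_distrib[of _ n])
  qed
  then show "finsum V f S \<in> carrier_mat n n"
    and "u \<in> carrier_vec n \<Longrightarrow> w \<in> carrier_vec n \<Longrightarrow>
      u \<bullet> (finsum V f S *\<^sub>v w) = (\<Sum>s\<in>S. u \<bullet> (f s *\<^sub>v w))" by auto
qed

text \<open>The first formula serves the sum of the \<open>z \<bullet> A y\<^sub>s\<close>, the
  second the local energies. The second also yields the symmetry of \<open>H\<close>, since each
  local pseudo-inverse is symmetric.\<close>

lemma op_H_form:
  assumes loc: "local_setting n N ns R At"
  shows "op_H n N R At \<in> carrier_mat n n"
    and "u \<in> carrier_vec n \<Longrightarrow> w \<in> carrier_vec n \<Longrightarrow> u \<bullet> (op_H n N R At *\<^sub>v w) =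
      (\<Sum>s\<in>{1..N}. u \<bullet> (transpose_mat (R s) *\<^sub>v (pinv (At s) *\<^sub>v (R s *\<^sub>v w))))"
    and "u \<in> carrier_vec n \<Longrightarrow> w \<in> carrier_vec n \<Longrightarrow> u \<bullet> (op_H n N R At *\<^sub>v w) =
      (\<Sum>s\<in>{1..N}. (R s *\<^sub>v u) \<bullet> (pinv (At s) *\<^sub>v (R s *\<^sub>v w)))"
    and "u \<in> carrier_vec n \<Longrightarrow> w \<in> carrier_vec n \<Longrightarrow>
      u \<bullet> (op_H n N R At *\<^sub>v w) = w \<bullet> (op_H n N R At *\<^sub>v u)"
proof -
  have R: "R s \<in> carrier_mat (ns s) n" and At: "At s \<in> carrier_mat (ns s) (ns s)"
    and sp: "transpose_mat (At s) = At s" if "s \<in> {1..N}" for s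
    using loc that unfolding local_setting_def spsd_mat_def by auto
  note B = pinv_sym_props[OF At sp]
  have loc_car: "transpose_mat (R s) * pinv (At s) * R s \<in> carrier_mat n n" if "s \<in> {1..N}" for s
    using R[OF that] B(1)[OF that that] by (intro mult_carrier_mat[of _ n "ns s"]) simp_all
  note fm = finsum_module_mat[of "{1..N}", OF _ loc_car, folded op_H_def]
  show "op_H n N R At \<in> carrier_mat n n" using fm(1) by simp
  have ap: "transpose_mat (R s) * pinv (At s) * R s *\<^sub>v w =
      transpose_mat (R s) *\<^sub>v (pinv (At s) *\<^sub>v (R s *\<^sub>v w))"
    if s: "s \<in> {1..N}" and w: "w \<in> carrier_vec n" for s w
    using R[OF s] B(1)[OF s s] w
    by (simp add: assoc_mult_mat_vec[of _ n "ns s" _ n] assoc_mult_mat_vec[of _ n "ns s" _ "ns s"])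
  have tr: "u \<bullet> (transpose_mat (R s) *\<^sub>v x) = (R s *\<^sub>v u) \<bullet> x"
    if "s \<in> {1..N}" "u \<in> carrier_vec n" "x \<in> carrier_vec (ns s)" for s u x
    using transpose_vec_mult_scalar[of "transpose_mat (R s)" n "ns s" x u] R[OF that(1)] that by simp
  have BR: "pinv (At s) *\<^sub>v (R s *\<^sub>v w) \<in> carrier_vec (ns s)"
    if "s \<in> {1..N}" "w \<in> carrier_vec n" for s w
    using R[OF that(1)] B(1)[OF that(1) that(1)] that by simp
  show 1: "u \<bullet> (op_H n N R At *\<^sub>v w) =
      (\<Sum>s\<in>{1..N}. u \<bullet> (transpose_mat (R s) *\<^sub>v (pinv (At s) *\<^sub>v (R s *\<^sub>v w))))"
    if "u \<in> carrier_vec n" "w \<in> carrier_vec n" for u w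
    using fm(2)[OF _ _ that] ap that by simp
  show 2: "u \<bullet> (op_H n N R At *\<^sub>v w) = (\<Sum>s\<in>{1..N}. (R s *\<^sub>v u) \<bullet> (pinv (At s) *\<^sub>v (R s *\<^sub>v w)))"
    if "u \<in> carrier_vec n" "w \<in> carrier_vec n" for u w
    unfolding 1[OF that] using tr BR that by (intro sum.cong) auto
  show "u \<bullet> (op_H n N R At *\<^sub>v w) = w \<bullet> (op_H n N R At *\<^sub>v u)"
    if "u \<in> carrier_vec n" "w \<in> carrier_vec n"
    unfolding 2[OF that] 2[OF that(2,1)]
  proof (rule sum.cong[OF refl])
    fix s assume s: "s \<in> {1..N}"
    show "(R s *\<^sub>v u) \<bullet> (pinv (At s) *\<^sub>v (R s *\<^sub>v w)) = (R s *\<^sub>v w) \<bullet> (pinv (At s) *\<^sub>v (R s *\<^sub>v u))"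
      by (rule scalar_prod_sym_mat[OF B(1,3)[OF s s]]) (use R[OF s] that in simp_all)
  qed
qed

lemma subset_sum_subspaces:
  assumes s: "s \<in> {1..N}" and W: "W s \<subseteq> carrier_vec n"
    and zero: "\<And>t. t \<in> {1..N} \<Longrightarrow> 0\<^sub>v n \<in> W t"
  shows "W s \<subseteq> sum_subspaces n N W"
proof
  fix e assume eW: "e \<in> W s"
  define f where "f t = (if t = s then e else 0\<^sub>v n)" for t
  have e: "e \<in> carrier_vec n" using eW W by blast
  have f: "f \<in> {1..N} \<rightarrow> carrier_vec n" using e by (simp add: f_def)
  have "finsum_vec TYPE(real) n f {1..N} = e"
  proof (rule eq_vecI)
    have "finsum_vec TYPE(real) n f {1..N} \<in> carrier_vec n" by (rule finsum_vec_closed[OF f])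
    then show "dim_vec (finsum_vec TYPE(real) n f {1..N}) = dim_vec e"
      using carrier_vecD[OF e] by simp
    fix i assume "i < dim_vec e"
    then have i: "i < n" using carrier_vecD[OF e] by simp
    have "finsum_vec TYPE(real) n f {1..N} $ i = (\<Sum>t\<in>{1..N}. f t $ i)"
      by (rule index_finsum_vec[OF _ i f]) simp
    also have "\<dots> = (\<Sum>t\<in>{1..N}. if t = s then e $ i else 0)"
      by (rule sum.cong) (auto simp: f_def i)
    also have "\<dots> = e $ i" using s by simp
    finally show "finsum_vec TYPE(real) n f {1..N} $ i = e $ i" .
  qed
  moreover have "\<forall>t\<in>{1..N}. f t \<in> W t" using eW zero by (simp add: f_def)
  ultimately show "e \<in> sum_subspaces n N W" unfolding sum_subspaces_def by force
qed

section \<open>The eigenvalue bound\<close>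

theorem lemma14:
  fixes n N Nc :: nat and ns :: "nat \<Rightarrow> nat"
    and A R0 :: "real mat" and R At Pi :: "nat \<Rightarrow> real mat"
    and V0 :: "real vec set" and \<omega> :: real
  assumes "n > 0"
    and "A \<in> carrier_mat n n" and "spd_mat A"
    and "local_setting n N ns R At"
    and "coarse_setting n V0 R0"
    and "is_coloring_constant A N ns R Nc"
    and "sum_subspaces n N (\<lambda>s. (\<lambda>x. transpose_mat (R s) *\<^sub>v x) ` mat_kernel (At s)) \<subseteq> V0"
    and "\<And>s. s \<in> {1..N} \<Longrightarrow> is_A_orth_projection A (Pi s) \<and>
           mat_kernel (Pi s) = (\<lambda>x. transpose_mat (R s) *\<^sub>v x) ` mat_kernel (At s)"
    and "\<omega> > 0"
    and "\<And>s x. s \<in> {1..N} \<Longrightarrow>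
           x \<in> mat_range (pinv (At s) * R s * transpose_mat (op_P0 A R0)) \<Longrightarrow>
           (energy_norm A (Pi s *\<^sub>v (transpose_mat (R s) *\<^sub>v x)))\<^sup>2 \<le> \<omega> * (energy_norm (At s) x)\<^sup>2"
  shows "has_real_spectrum (op_H n N R At * A * op_P0 A R0) \<and>
         largest_eigenvalue (op_H n N R At * A * op_P0 A R0) \<le> real Nc * \<omega>"
proof -
  note npos = assms(1) and A = assms(2) and spd = assms(3) and loc = assms(4) and cs = assms(5)
    and kerV0 = assms(7) and Pi = assms(8) and om = assms(9) and bound = assms(10)
  define P where "P = op_P0 A R0"
  define H where "H = op_H n N R At"
  define S where "S = A * P"
  note Pp = op_P0_props[OF A spd cs, folded P_def]
  note Hf = op_H_form[OF loc, folded H_def]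
  have P: "P \<in> carrier_mat n n" and H: "H \<in> carrier_mat n n" using Pp Hf by simp_all
  have S: "S \<in> carrier_mat n n" unfolding S_def using A P by simp
  have symA: "transpose_mat A = A" using spd by (simp add: spd_mat_def)
  have R: "R s \<in> carrier_mat (ns s) n" and At: "At s \<in> carrier_mat (ns s) (ns s)"
    and spsd: "spsd_mat (At s)" if "s \<in> {1..N}" for s
    using loc that unfolding local_setting_def by auto
  have symAt: "transpose_mat (At s) = At s" if "s \<in> {1..N}" for s
    using spsd[OF that] by (simp add: spsd_mat_def)
  note B = pinv_sym_props[OF At symAt]
  have Av: "A *\<^sub>v x \<in> carrier_vec n" and Pv: "P *\<^sub>v x \<in> carrier_vec n"
    if "x \<in> carrier_vec n" for x using A P that by simp_all
  have pos: "0 < x \<bullet> (A *\<^sub>v x)" if "x \<in> carrier_vec n" "x \<noteq> 0\<^sub>v n" for x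
    using spd A that unfolding spd_mat_def by auto
  have nonneg: "0 \<le> x \<bullet> (A *\<^sub>v x)" if "x \<in> carrier_vec n" for x
    using pos[OF that] that A by (cases "x = 0\<^sub>v n") (auto simp: mult_mat_zero_vec)
  have spsdA: "spsd_mat A" unfolding spsd_mat_def using A symA nonneg by auto
  have Sv: "S *\<^sub>v x = A *\<^sub>v (P *\<^sub>v x)" if "x \<in> carrier_vec n" for x
    unfolding S_def by (rule assoc_mult_mat_vec[OF A P that])
  \<comment> \<open>This second factorization of \<open>S\<close> puts \<open>S x\<close> in the
    range of the transpose of \<open>P\<close>, as the range condition in \<open>bound\<close>
    demands.\<close>
  have Sv': "S *\<^sub>v x = transpose_mat P *\<^sub>v (A *\<^sub>v x)" if "x \<in> carrier_vec n" for x
    unfolding S_def Pp(2)[symmetric] using assoc_mult_mat_vec[of "transpose_mat P" n n A n x] P A that by simp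
  have symS: "transpose_mat S = S"
    unfolding S_def transpose_mult[OF A P] symA by (rule Pp(2))
  have P_adj: "(P *\<^sub>v x) \<bullet> (A *\<^sub>v y) = x \<bullet> (A *\<^sub>v (P *\<^sub>v y))"
    if x: "x \<in> carrier_vec n" and y: "y \<in> carrier_vec n" for x y
  proof -
    have "(P *\<^sub>v x) \<bullet> (A *\<^sub>v y) = (S *\<^sub>v y) \<bullet> x"
      unfolding Sv'[OF y] using transpose_vec_mult_scalar[OF P x Av[OF y]]
        comm_scalar_prod[OF Pv[OF x] Av[OF y]] by simp
    then show ?thesis
      using Sv[OF y] comm_scalar_prod[OF Av[OF Pv[OF y]] x] by simp
  qed
  have V0_orth: "(P *\<^sub>v x) \<bullet> (A *\<^sub>v d) = 0"
    if "x \<in> carrier_vec n" "d \<in> V0" "d \<in> carrier_vec n" for x d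
    using P_adj[OF that(1,3)] Pp(3)[OF that(2)] that(1) A by (simp add: mult_mat_zero_vec)
  \<comment> \<open>\<open>x - P x\<close> lies in \<open>V0\<close>, to which \<open>P x\<close> is
    \<open>A\<close>-orthogonal; hence \<open>S\<close> is the form of the squared
    \<open>A\<close>-norm of \<open>P x\<close>.\<close>
  have S_form: "x \<bullet> (S *\<^sub>v x) = (P *\<^sub>v x) \<bullet> (A *\<^sub>v (P *\<^sub>v x))" if x: "x \<in> carrier_vec n" for x
  proof -
    have "(P *\<^sub>v x) \<bullet> (A *\<^sub>v (x - P *\<^sub>v x)) = 0"
      by (rule V0_orth[OF x Pp(4)[OF x]]) (use x Pv in simp)
    then have "(P *\<^sub>v x) \<bullet> (A *\<^sub>v x) = (P *\<^sub>v x) \<bullet> (A *\<^sub>v (P *\<^sub>v x))"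
      using x Av Pv by (simp add: mult_minus_distrib_mat_vec[OF A] scalar_prod_minus_distrib[of _ n])
    then show ?thesis using P_adj[OF x x] Sv[OF x] by simp
  qed
  have S_zero: "S *\<^sub>v x = 0\<^sub>v n" if x: "x \<in> carrier_vec n" and 0: "x \<bullet> (S *\<^sub>v x) = 0" for x
  proof -
    have "P *\<^sub>v x = 0\<^sub>v n" using pos[OF Pv[OF x]] S_form[OF x] 0 by fastforce
    then show ?thesis using Sv[OF x] A by (simp add: mult_mat_zero_vec)
  qed
  have HAP: "H * A * P = H * S" unfolding S_def by (rule assoc_mult_mat[OF H A P])
  have HS: "H * S \<in> carrier_mat n n" using H S by simp
  have "spectrum (map_mat complex_of_real (H * S)) \<subseteq> \<real>"
    by (rule real_spectrum_sym_mult_spsd[OF H S Hf(4) symS])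
      (use S_form nonneg Pv S_zero in auto)
  then have real: "has_real_spectrum (H * S)"
    by (rule has_real_spectrumI[OF HS npos])
  \<comment> \<open>The inclusion in \<open>V0\<close> is assumed for the Minkowski sum; a single
    summand lies in that sum because every kernel image contains zero.\<close>
  have ker_sub: "transpose_mat (R s) *\<^sub>v k \<in> V0"
    if s: "s \<in> {1..N}" and k: "k \<in> mat_kernel (At s)" for s k
  proof -
    let ?W = "\<lambda>t. (\<lambda>x. transpose_mat (R t) *\<^sub>v x) ` mat_kernel (At t)"
    have "0\<^sub>v n \<in> ?W t" if t: "t \<in> {1..N}" for t
    proof (rule image_eqI)
      show "0\<^sub>v n = transpose_mat (R t) *\<^sub>v 0\<^sub>v (ns t)"
        using R[OF t] by (intro mult_mat_zero_vec[symmetric]) simp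
      show "0\<^sub>v (ns t) \<in> mat_kernel (At t)"
        using At[OF t] by (intro mat_kernelI) (auto simp: mult_mat_zero_vec)
    qed
    moreover have "?W s \<subseteq> carrier_vec n"
      using R[OF s] mat_kernelD(1)[OF At[OF s]] mult_mat_vec_carrier[of "transpose_mat (R s)" n "ns s"]
      by auto
    ultimately have "?W s \<subseteq> V0"
      using subset_sum_subspaces[OF s, where n = n and W = ?W] kerV0 by blast
    then show ?thesis using k by blast
  qed
  have bnd: "l \<le> real Nc * \<omega>" if l: "l \<in> spectrum (H * S)" for l
  proof (cases "l \<le> 0")
    case True
    then show ?thesis using om by (meson less_imp_le mult_nonneg_nonneg of_nat_0_le_iff order_trans)
  next
    case False
    then have lpos: "l > 0" by simp
    obtain v where v: "v \<in> carrier_vec n" "v \<noteq> 0\<^sub>v n" and "(H * S) *\<^sub>v v = l \<cdot>\<^sub>v v"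
      using l HS unfolding spectrum_def eigenvalue_def eigenvector_def by auto
    then have ev: "H *\<^sub>v (S *\<^sub>v v) = l \<cdot>\<^sub>v v" using assoc_mult_mat_vec[OF H S v(1)] by simp
    define z w q where "z = P *\<^sub>v v" and "w = S *\<^sub>v v" and "q = z \<bullet> (A *\<^sub>v z)"
    have z: "z \<in> carrier_vec n" unfolding z_def by (rule Pv[OF v(1)])
    have w: "w \<in> carrier_vec n" unfolding w_def using S v by simp
    have wAz: "w = A *\<^sub>v z" unfolding w_def z_def by (rule Sv[OF v(1)])
    have qS: "q = v \<bullet> w" unfolding q_def z_def w_def by (rule S_form[OF v(1), symmetric])
    \<comment> \<open>Otherwise \<open>w = 0\<close>, and then \<open>l v = H w = 0\<close>
      contradicts \<open>l > 0\<close> and \<open>v \<noteq> 0\<close>.\<close>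
    have "q \<noteq> 0"
    proof
      assume "q = 0"
      then have "w = 0\<^sub>v n" unfolding w_def by (intro S_zero v) (simp add: qS[unfolded w_def])
      then have "l \<cdot>\<^sub>v v = 0\<^sub>v n" using ev H unfolding w_def by (simp add: mult_mat_zero_vec)
      then have "(l \<cdot>\<^sub>v v) $ i = 0" if "i < n" for i using that by simp
      then have "v $ i = 0" if "i < n" for i using that v lpos by fastforce
      then show False using v by (metis carrier_vecD eq_vecI index_zero_vec)
    qed
    then have qpos: "q > 0" using nonneg[OF z] by (simp add: q_def)
    have lq: "w \<bullet> (H *\<^sub>v w) = l * q"
      unfolding w_def ev using v w comm_scalar_prod[OF v(1) w] by (simp add: qS w_def)
    define x where "x s = pinv (At s) *\<^sub>v (R s *\<^sub>v w)" for s
    define r where "r s = transpose_mat (R s) *\<^sub>v x s" for s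
    define y where "y s = Pi s *\<^sub>v r s" for s
    have Rw: "R s *\<^sub>v w \<in> carrier_vec (ns s)" and x: "x s \<in> carrier_vec (ns s)"
      and r: "r s \<in> carrier_vec n" if "s \<in> {1..N}" for s
      unfolding x_def r_def using R[OF that] B(1)[OF that that] w by simp_all
    have Pis: "Pi s \<in> carrier_mat n n" "Pi s * Pi s = Pi s"
      "mat_kernel (Pi s) = (\<lambda>x. transpose_mat (R s) *\<^sub>v x) ` mat_kernel (At s)" if "s \<in> {1..N}" for s
      using Pi[OF that] A unfolding is_A_orth_projection_def by auto
    have y: "y s \<in> carrier_vec n" if "s \<in> {1..N}" for s
      unfolding y_def using Pis(1)[OF that] r[OF that] by simp
    \<comment> \<open>\<open>Pi s\<close> fixes \<open>y s\<close>, being idempotent, so the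
      difference lies in its kernel.\<close>
    have split: "\<exists>k \<in> mat_kernel (At s). r s - y s = transpose_mat (R s) *\<^sub>v k" if s: "s \<in> {1..N}" for s
    proof -
      have "Pi s *\<^sub>v y s = y s"
        unfolding y_def using assoc_mult_mat_vec[OF Pis(1)[OF s] Pis(1)[OF s] r[OF s]] Pis(2)[OF s] by simp
      then have "Pi s *\<^sub>v (r s - y s) = 0\<^sub>v n"
        using mult_minus_distrib_mat_vec[OF Pis(1)[OF s] r[OF s] y[OF s]] y[OF s] by (simp add: y_def)
      then have "r s - y s \<in> mat_kernel (Pi s)"
        using r[OF s] y[OF s] by (intro mat_kernelI[OF Pis(1)[OF s]]) simp_all
      then show ?thesis unfolding Pis(3)[OF s] by auto
    qed
    have zy: "z \<bullet> (A *\<^sub>v y s) = w \<bullet> r s" if s: "s \<in> {1..N}" for s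
    proof -
      have "r s - y s \<in> V0" using split[OF s] ker_sub[OF s] by auto
      then have "z \<bullet> (A *\<^sub>v (r s - y s)) = 0"
        unfolding z_def using r[OF s] y[OF s] v by (intro V0_orth) simp_all
      then have "z \<bullet> (A *\<^sub>v r s) = z \<bullet> (A *\<^sub>v y s)"
        using r[OF s] y[OF s] z Av
        by (simp add: mult_minus_distrib_mat_vec[OF A] scalar_prod_minus_distrib[of _ n])
      then show ?thesis
        using scalar_prod_sym_mat[OF A symA z r[OF s]] comm_scalar_prod[OF r[OF s] w] wAz by simp
    qed
    have sum_zy: "(\<Sum>s\<in>{1..N}. z \<bullet> (A *\<^sub>v y s)) = l * q"
      using Hf(2)[OF w w] lq zy by (simp add: r_def x_def)
    \<comment> \<open>Subtracting an element of the kernel image keeps \<open>y s\<close> in the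
      range of the transpose of \<open>R s\<close>, so the colouring condition applies to
      it.\<close>
    have y_range: "\<exists>u \<in> carrier_vec (ns s). y s = transpose_mat (R s) *\<^sub>v u" if s: "s \<in> {1..N}" for s
    proof -
      obtain k where k: "k \<in> mat_kernel (At s)" "r s - y s = transpose_mat (R s) *\<^sub>v k"
        using split[OF s] by auto
      have kc: "k \<in> carrier_vec (ns s)" by (rule mat_kernelD(1)[OF At[OF s] k(1)])
      have "y s = r s - (r s - y s)" using r[OF s] y[OF s] by (intro eq_vecI) auto
      also have "\<dots> = transpose_mat (R s) *\<^sub>v (x s - k)"
        unfolding k(2) unfolding r_def using R[OF s]
        by (intro mult_minus_distrib_mat_vec[symmetric, OF _ x[OF s] kc]) simp
      finally show ?thesis using x[OF s] kc by (intro bexI[of _ "x s - k"]) simp_all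
    qed
    obtain C where C: "is_coloring A N ns R Nc C"
      using assms(6) unfolding is_coloring_constant_def by auto
    have cover: "{1..N} = (\<Union>j\<in>{1..Nc}. C j)" using C unfolding is_coloring_def by blast
    have orth: "y s \<bullet> (A *\<^sub>v y t) = 0"
      if j: "j \<in> {1..Nc}" and "s \<in> C j \<inter> {1..N}" "t \<in> C j \<inter> {1..N}" and ne: "s \<noteq> t" for j s t
    proof -
      have s: "s \<in> {1..N}" "s \<in> C j" and t: "t \<in> {1..N}" "t \<in> C j" using that by auto
      have zero: "R s * A * transpose_mat (R t) = 0\<^sub>m (ns s) (ns t)"
        using C j s(2) t(2) ne unfolding is_coloring_def by blast
      obtain us where us: "us \<in> carrier_vec (ns s)" "y s = transpose_mat (R s) *\<^sub>v us"
        using y_range[OF s(1)] by auto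
      obtain ut where ut: "ut \<in> carrier_vec (ns t)" "y t = transpose_mat (R t) *\<^sub>v ut"
        using y_range[OF t(1)] by auto
      have Rt: "transpose_mat (R t) \<in> carrier_mat n (ns t)" using R[OF t(1)] by simp
      have RA: "R s * A \<in> carrier_mat (ns s) n" using R[OF s(1)] A by simp
      have "y s \<bullet> (A *\<^sub>v y t) = us \<bullet> (R s *\<^sub>v (A *\<^sub>v y t))"
        unfolding us(2) by (rule transpose_vec_mult_scalar[OF R[OF s(1)] Av[OF y[OF t(1)]] us(1)])
      also have "R s *\<^sub>v (A *\<^sub>v y t) = (R s * A * transpose_mat (R t)) *\<^sub>v ut"
        using assoc_mult_mat_vec[OF RA Rt ut(1)] assoc_mult_mat_vec[OF R[OF s(1)] A y[OF t(1)]] ut(2)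
        by simp
      also have "\<dots> = 0\<^sub>v (ns s)" unfolding zero using ut(1) by (intro eq_vecI) auto
      finally show ?thesis using us(1) by simp
    qed
    have y_bound: "y s \<bullet> (A *\<^sub>v y s) \<le> \<omega> * ((R s *\<^sub>v w) \<bullet> (pinv (At s) *\<^sub>v (R s *\<^sub>v w)))"
      if s: "s \<in> {1..N}" for s
    proof -
      have BR: "pinv (At s) * R s \<in> carrier_mat (ns s) n" using B(1)[OF s s] R[OF s] by simp
      have Pt: "transpose_mat P \<in> carrier_mat n n" using P by simp
      have "x s = (pinv (At s) * R s) *\<^sub>v w"
        unfolding x_def by (rule assoc_mult_mat_vec[OF B(1)[OF s s] R[OF s] w, symmetric])
      also have "\<dots> = (pinv (At s) * R s * transpose_mat P) *\<^sub>v (A *\<^sub>v v)"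
        unfolding w_def Sv'[OF v(1)] by (rule assoc_mult_mat_vec[OF BR Pt Av[OF v(1)], symmetric])
      finally have "x s \<in> mat_range (pinv (At s) * R s * transpose_mat (op_P0 A R0))"
        unfolding mat_range_def P_def[symmetric] using Av[OF v(1)] P by auto
      note bs = bound[OF s this]
      have "0 \<le> x s \<bullet> (At s *\<^sub>v x s)" using spsd[OF s] x[OF s] At[OF s] unfolding spsd_mat_def by auto
      then have "y s \<bullet> (A *\<^sub>v y s) \<le> \<omega> * (x s \<bullet> (At s *\<^sub>v x s))"
        using bs nonneg[OF y[OF s]] unfolding energy_norm_def by (simp add: y_def r_def)
      \<comment> \<open>By the identity \<open>B(2)\<close> the local energy of \<open>x s\<close>
        is exactly the summand of index \<open>s\<close> in \<open>w \<bullet> H w\<close>.\<close>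
      also have "x s \<bullet> (At s *\<^sub>v x s) = (R s *\<^sub>v w) \<bullet> (pinv (At s) *\<^sub>v (At s *\<^sub>v x s))"
        using transpose_vec_mult_scalar[OF B(1)[OF s s] _ Rw[OF s], of "At s *\<^sub>v x s"] B(3)[OF s s]
          x[OF s] At[OF s] by (simp add: x_def)
      also have "pinv (At s) *\<^sub>v (At s *\<^sub>v x s) = (pinv (At s) * At s * pinv (At s)) *\<^sub>v (R s *\<^sub>v w)"
      proof -
        have BA: "pinv (At s) * At s \<in> carrier_mat (ns s) (ns s)" using B(1)[OF s s] At[OF s] by simp
        show ?thesis
          using assoc_mult_mat_vec[OF BA B(1)[OF s s] Rw[OF s]]
            assoc_mult_mat_vec[OF B(1)[OF s s] At[OF s] x[OF s]] by (simp add: x_def)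
      qed
      finally show ?thesis unfolding B(2)[OF s s] .
    qed
    have sum_y: "(\<Sum>s\<in>{1..N}. y s \<bullet> (A *\<^sub>v y s)) \<le> \<omega> * (l * q)"
    proof -
      have "(\<Sum>s\<in>{1..N}. y s \<bullet> (A *\<^sub>v y s))
          \<le> (\<Sum>s\<in>{1..N}. \<omega> * ((R s *\<^sub>v w) \<bullet> (pinv (At s) *\<^sub>v (R s *\<^sub>v w))))"
        by (rule sum_mono) (rule y_bound)
      also have "\<dots> = \<omega> * (l * q)"
        unfolding sum_distrib_left[symmetric] Hf(3)[OF w w, symmetric] lq ..
      finally show ?thesis .
    qed
    \<comment> \<open>Without colours there would be no subdomains, and \<open>sum_zy\<close> would
      read \<open>0 = l * q\<close>.\<close>
    have Nc: "real Nc > 0"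
    proof (rule ccontr)
      assume "\<not> real Nc > 0"
      then have "{1..N} = {}" using cover by simp
      then show False using sum_zy lpos qpos by simp
    qed
    \<comment> \<open>This value minimizes \<open>Nc c\<^sup>2 q - 2 c l q\<close> over
      \<open>c\<close>; the minimum is \<open>- l\<^sup>2 q / Nc\<close>.\<close>
    define c where "c = l / real Nc"
    have cz: "c \<cdot>\<^sub>v z \<in> carrier_vec n" using z by simp
    have "0 \<le> real Nc * ((c \<cdot>\<^sub>v z) \<bullet> (A *\<^sub>v (c \<cdot>\<^sub>v z)))
        - 2 * (\<Sum>s\<in>{1..N}. (c \<cdot>\<^sub>v z) \<bullet> (A *\<^sub>v y s)) + (\<Sum>s\<in>{1..N}. y s \<bullet> (A *\<^sub>v y s))"
      by (rule sum_form_coloring_nonneg[OF A spsdA _ y equalityD1[OF cover] _ cz])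
        (simp, assumption, rule orth, assumption+)
    also have "(c \<cdot>\<^sub>v z) \<bullet> (A *\<^sub>v (c \<cdot>\<^sub>v z)) = c\<^sup>2 * q"
      using z Av[OF z] by (simp add: mult_mat_vec[OF A z] q_def power2_eq_square)
    also have "(\<Sum>s\<in>{1..N}. (c \<cdot>\<^sub>v z) \<bullet> (A *\<^sub>v y s)) = c * (l * q)"
      unfolding sum_zy[symmetric] sum_distrib_left
      by (intro sum.cong refl smult_scalar_prod_distrib[OF z Av[OF y]])
    finally have "0 \<le> real Nc * (c\<^sup>2 * q) - 2 * (c * (l * q)) + \<omega> * (l * q)" using sum_y by linarith
    also have "\<dots> = (l * q) * (\<omega> - l / real Nc)"
      using Nc by (simp add: c_def field_simps power2_eq_square)
    finally have "0 \<le> \<omega> - l / real Nc"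
      using mult_pos_pos[OF lpos qpos] by (simp only: zero_le_mult_iff) linarith
    then show ?thesis using Nc by (simp add: field_simps)
  qed
  \<comment> \<open>\<open>Max\<close> is the true maximum only on a finite nonempty set.\<close>
  have "spectrum (H * S) \<noteq> {}" using real unfolding has_real_spectrum_def by simp
  then have "largest_eigenvalue (H * S) \<le> real Nc * \<omega>"
    unfolding largest_eigenvalue_def using card_finite_spectrum(1)[OF HS] bnd by simp
  then show ?thesis using real HAP unfolding H_def P_def by simp
qed

end
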